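(* Let $X$ be a real Banach space and $B_n\in\mathscr{L}(X)$, $n\in\{0,1,2,\ldots\}$. If the system $v_{n+1}=B_nv_n$ has an exponential dichotomy with values $a<b$ and decomposition $X=X_{\mathrm s}(n)\oplus X_{\mathrm u}(n)$, then there exist semi-norms $\widetilde I_n^-,\widetilde I_n^+$ on $X$ ($n\ge0$) and a constant $c_1>0$ independent of $n$ such that for all $n\ge0$ \begin{gather*} c_1\|v\|_X\le \widetilde I_n^-(v)+\widetilde I_n^+(v)\le\tfrac1{c_1}\|v\|_X\quad\text{for all }v\in X,\\ X_{\mathrm s}(n)=\{v_n\in X:\widetilde I_n^+(v_n)=0\},\\ X_{\mathrm u}(n)=\{v_n\in X:\widetilde I_n^-(v_n)=0\},\\ \widetilde I_{n+1}^-(B_nv_n)\le a\,\widetilde I_n^-(v_n)\quad\text{for all }v_n\in X,\\ \widetilde I_{n+1}^+(B_nv_n)\ge b\,\widetilde I_n^+(v_n)\quad\text{for all }v_n\in X. \end{gather*} If $X_{\mathrm s}(n)$ has finite codimension $K$, then $\widetilde I_n^+$ moreover satisfies: there exist $c_2>0$ and $\alpha_{k,n}^+\in X^*$ for $(k,n)\in\{1,\ldots,K\}\times\{0,1,\ldots\}$ such that for all $n\ge0$ and $v\in X$ $$c_2\max_{1\le k\le K}|\langle\alpha_{k,n}^+,v\rangle|\le\widetilde I_n^+(v)\le\frac1{c_2}\max_{1\le k\le K}|\langle\alpha_{k,n}^+,v\rangle|.$$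
   Context: $\mathscr{L}(X)$ denotes bounded linear operators on $X$; a maximum over an empty index set is $0$. For $n\le m$: $B(n,n):=\mathrm{Id}$, $B(m,n):=B_{m-1}B_{m-2}\cdots B_n$. Exponential dichotomy: the system $v_{n+1}=B_nv_n$ has an exponential dichotomy with values $a$ and $b$, $0<a<b$, if for all $n\ge 0$ there is a direct sum decomposition $X=X_{\mathrm s}(n)\oplus X_{\mathrm u}(n)$ with associated projections $\pi_{\mathrm s}(n):X\to X_{\mathrm s}(n)$, $\pi_{\mathrm u}(n):X\to X_{\mathrm u}(n)$ such that for some $C>0$ and all $n\le m$: (1) $B(m,n)\circ\pi_{\mathrm s}(n)=\pi_{\mathrm s}(m)\circ B(m,n)$ and $B(m,n)\circ\pi_{\mathrm u}(n)=\pi_{\mathrm u}(m)\circ B(m,n)$; (2) $\|\pi_{\mathrm s}(n)\|_{\mathscr{L}(X)}+\|\pi_{\mathrm u}(n)\|_{\mathscr{L}(X)}\le C$; (3) $B(m,n)|_{X_{\mathrm u}(n)}:X_{\mathrm u}(n)\to X_{\mathrm u}(m)$ is invertible; (4) $\|B(m,n)v_n\|\le Ca^{m-n}\|v_n\|$ for all $v_n\in X_{\mathrm s}(n)$; (5) $\|B(m,n)^{-1}v_m\|\le Cb^{n-m}\|v_m\|$ for all $v_m\in X_{\mathrm u}(m)$, where $B(m,n)^{-1}$ is the inverse of the restriction in (3). *)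

theory Defs
  imports "HOL-Analysis.Analysis"
begin

primrec evol :: "(nat \<Rightarrow> 'a \<Rightarrow>\<^sub>L 'a) \<Rightarrow> nat \<Rightarrow> nat \<Rightarrow> 'a::real_normed_vector \<Rightarrow>\<^sub>L 'a" where
  "evol B 0 n = id_blinfun"
| "evol B (Suc m) n = (if n \<le> m then B m o\<^sub>L evol B m n else id_blinfun)"

(* Only pairs n \<le> m matter, and for those evol B m n = B (m-1) ... B n: *)

lemma evol_refl: "evol B n n = id_blinfun"
  by (cases n) auto

lemma evol_Suc: "n \<le> m \<Longrightarrow> evol B (Suc m) n = B m o\<^sub>L evol B m n"
  by simp

definition direct_sum :: "'a::real_vector set \<Rightarrow> 'a set \<Rightarrow> bool" where
  "direct_sum S U \<longleftrightarrow> subspace S \<and> subspace U \<and> S \<inter> U = {0} \<and> {s + u | s u. s \<in> S \<and> u \<in> U} = UNIV"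

(* If direct_sum S U holds, P is uniquely determined: it is the projection onto S along U. *)
definition projection_along ::
    "'a::real_normed_vector set \<Rightarrow> 'a set \<Rightarrow> ('a \<Rightarrow>\<^sub>L 'a) \<Rightarrow> bool" where
  "projection_along S U P \<longleftrightarrow> (\<forall>s\<in>S. \<forall>u\<in>U. P (s + u) = s)"

(* The uniform operator norm bound on the projections presupposes that they are bounded,
   so they are taken as elements of the type of bounded linear operators. *)
definition exp_dichotomy ::
    "(nat \<Rightarrow> 'a \<Rightarrow>\<^sub>L 'a) \<Rightarrow> real \<Rightarrow> real \<Rightarrow> (nat \<Rightarrow> 'a set) \<Rightarrow> (nat \<Rightarrow> 'a::real_normed_vector set) \<Rightarrow> bool" where
  "exp_dichotomy B a b Xs Xu \<longleftrightarrow>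
     0 < a \<and> a < b \<and>
     (\<forall>n. direct_sum (Xs n) (Xu n)) \<and>
     (\<exists>\<pi>s \<pi>u :: nat \<Rightarrow> 'a \<Rightarrow>\<^sub>L 'a.
        (\<forall>n. projection_along (Xs n) (Xu n) (\<pi>s n) \<and> projection_along (Xu n) (Xs n) (\<pi>u n)) \<and>
        (\<exists>C>0. \<forall>n m. n \<le> m \<longrightarrow>
           evol B m n o\<^sub>L \<pi>s n = \<pi>s m o\<^sub>L evol B m n \<and>
           evol B m n o\<^sub>L \<pi>u n = \<pi>u m o\<^sub>L evol B m n \<and>
           norm (\<pi>s n) + norm (\<pi>u n) \<le> C \<and>
           bij_betw (evol B m n) (Xu n) (Xu m) \<and>
           (\<forall>v\<in>Xs n. norm (evol B m n v) \<le> C * a ^ (m - n) * norm v) \<and>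
           (\<forall>v\<in>Xu m. norm (inv_into (Xu n) (evol B m n) v) \<le> C * b powi (int n - int m) * norm v)))"

definition is_seminorm :: "('a::real_vector \<Rightarrow> real) \<Rightarrow> bool" where
  "is_seminorm p \<longleftrightarrow>
     (\<forall>v. 0 \<le> p v) \<and> (\<forall>c v. p (c *\<^sub>R v) = \<bar>c\<bar> * p v) \<and> (\<forall>v w. p (v + w) \<le> p v + p w)"

(* The quotient of the whole space by S has dimension K: the cosets of w 1, ..., w K
   are linearly independent in, and span, the quotient. *)
definition has_codim :: "'a::real_vector set \<Rightarrow> nat \<Rightarrow> bool" where
  "has_codim S K \<longleftrightarrow> subspace S \<and>
     (\<exists>w :: nat \<Rightarrow> 'a.
        (\<forall>c :: nat \<Rightarrow> real. (\<Sum>k=1..K. c k *\<^sub>R w k) \<in> S \<longrightarrow> (\<forall>k\<in>{1..K}. c k = 0)) \<and>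
        (\<forall>v. \<exists>c :: nat \<Rightarrow> real. v - (\<Sum>k=1..K. c k *\<^sub>R w k) \<in> S))"

(* A maximum over an empty index set is 0. *)
definition max_upto :: "nat \<Rightarrow> (nat \<Rightarrow> real) \<Rightarrow> real" where
  "max_upto K f = (if K = 0 then 0 else Max (f ` {1..K}))"

end

theory Submission
  imports Defs
begin

text \<open>
  Let \<open>\<pi>s n\<close> and \<open>\<pi>u n\<close> be the dichotomy projections. The seminorms are the norms of the two
  components of \<open>v\<close>, adapted to the dynamics in the manner of Lyapunov. The stable component is
  followed into the whole future and the unstable one into the whole available past, and each step
  is discounted by its rate:
  \<open>I\<^sup>-\<^sub>n v = sup\<^sub>m\<^sub>\<ge>\<^sub>n a\<^sup>n\<^sup>-\<^sup>m \<parallel>B(m,n) \<pi>s(n) v\<parallel>\<close> and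
  \<open>I\<^sup>+\<^sub>n v = sup\<^sub>k\<^sub>\<le>\<^sub>n b\<^sup>n\<^sup>-\<^sup>k \<parallel>B(n,k)\<^sup>-\<^sup>1 \<pi>u(n) v\<parallel>\<close>.
  The dichotomy estimates bound these suprema by \<open>C \<parallel>\<pi>s(n) v\<parallel>\<close> and \<open>C \<parallel>\<pi>u(n) v\<parallel>\<close>, and the terms
  \<open>m = n\<close> and \<open>k = n\<close> bound them from below by the norms of the components. This gives the equivalence
  with the norm and identifies the kernels. Passing from \<open>v\<close> at time \<open>n\<close> to \<open>B\<^sub>n v\<close> at
  time \<open>n + 1\<close> removes the index \<open>m = n\<close> from the first supremum and adds \<open>k = n + 1\<close> to the second,
  while all other terms are multiplied by exactly \<open>a\<close> and \<open>b\<close> respectively. So the rates hold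
  without any constant.

  For the functionals, \<open>I\<^sup>+\<^sub>n\<close> is equivalent, uniformly in \<open>n\<close>, to \<open>\<parallel>\<pi>u(n) v\<parallel>\<close>, a norm on a space of
  dimension \<open>K\<close>. What is needed is a basis of unit vectors whose coordinate functionals are bounded
  by a constant depending on \<open>K\<close> only. Transporting a fixed basis of \<open>Xu 0\<close> by \<open>B(n,0)\<close> would not do, as
  its condition number may grow with \<open>n\<close>. Instead lemma \<open>well_conditioned_coordinates\<close> builds a fresh basis
  for each \<open>n\<close> by repeated use of Riesz' lemma. This is weaker than Auerbach's lemma but elementary.
\<close>

section \<open>Seminorms\<close>

lemma is_seminormD:
  assumes "is_seminorm p"
  shows "0 \<le> p v" "p (c *\<^sub>R v) = \<bar>c\<bar> * p v" "p (v + w) \<le> p v + p w"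
  using assms by (auto simp: is_seminorm_def)

lemma is_seminorm_norm_linear:
  assumes f: "linear f" and c: "0 \<le> c"
  shows "is_seminorm (\<lambda>v. c * norm (f v))"
proof -
  have "c * norm (f v + f w) \<le> c * norm (f v) + c * norm (f w)" for v w
    using mult_left_mono[OF norm_triangle_ineq c] by (simp add: distrib_left)
  then show ?thesis
    using c by (simp add: is_seminorm_def linear_add[OF f] linear_scale[OF f])
qed

lemma is_seminorm_SUP:
  fixes p :: "'i \<Rightarrow> 'a::real_vector \<Rightarrow> real"
  assumes ne: "A \<noteq> {}" and p: "\<And>i. i \<in> A \<Longrightarrow> is_seminorm (p i)"
    and bdd: "\<And>v. bdd_above ((\<lambda>i. p i v) ` A)"
  shows "is_seminorm (\<lambda>v. SUP i\<in>A. p i v)"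
  unfolding is_seminorm_def
proof (intro conjI allI)
  fix v w :: 'a and c :: real
  let ?P = "\<lambda>v. SUP i\<in>A. p i v"
  note upper = cSUP_upper[OF _ bdd]
  have nonneg: "0 \<le> ?P v" for v
    using ne is_seminormD(1)[OF p] upper by (metis all_not_in_conv order_trans)
  then show "0 \<le> ?P v" .
  have le: "?P (c *\<^sub>R v) \<le> \<bar>c\<bar> * ?P v" for c v
    by (rule cSUP_least[OF ne])
      (use upper in \<open>auto simp: is_seminormD(2)[OF p] intro: mult_left_mono\<close>)
  \<comment> \<open>For \<open>c \<noteq> 0\<close>, the reverse inequality is the one above for \<open>1 / c\<close> and \<open>c v\<close>.\<close>
  show "?P (c *\<^sub>R v) = \<bar>c\<bar> * ?P v"
  proof (cases "c = 0")
    case True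
    then show ?thesis using le[of 0 v] nonneg[of "0 *\<^sub>R v"] by auto
  next
    case False
    then have "\<bar>c\<bar> * ?P v \<le> ?P (c *\<^sub>R v)"
      using le[of "inverse c" "c *\<^sub>R v"] by (simp add: field_simps)
    then show ?thesis using le[of c v] by simp
  qed
  show "?P (v + w) \<le> ?P v + ?P w"
    by (rule cSUP_least[OF ne])
      (use is_seminormD(3)[OF p] upper in \<open>meson add_mono order_trans\<close>)
qed

section \<open>Well-conditioned coordinates on finite-dimensional subspaces\<close>

text \<open>
  Coordinates of a convergent sequence in the span are Cauchy, hence converge, and the limits are
  coordinates of the limit vector. The ambient space may be infinite-dimensional. In
  \<open>well_conditioned_coordinates\<close> the induction hypothesis supplies the bounded coordinates.
\<close>

lemma span_closed_if_bounded_coordinates: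
  fixes T :: "'a::real_normed_vector set"
  assumes fin: "finite T"
    and e: "\<And>t. t \<in> T \<Longrightarrow> e t \<in> span T"
    and lin: "\<And>t. t \<in> T \<Longrightarrow> linear (f t)"
    and bound: "\<And>t v. t \<in> T \<Longrightarrow> v \<in> span T \<Longrightarrow> \<bar>f t v\<bar> \<le> M * norm v"
    and expand: "\<And>v. v \<in> span T \<Longrightarrow> v = (\<Sum>t\<in>T. f t v *\<^sub>R e t)"
  shows "closed (span T)"
  unfolding closed_sequential_limits
proof (intro allI impI, elim conjE)
  fix x :: "nat \<Rightarrow> 'a" and l :: 'a
  assume x: "\<forall>n. x n \<in> span T" and lim: "x \<longlonglongrightarrow> l"
  have conv: "convergent (\<lambda>n. f t (x n))" if t: "t \<in> T" for t
  proof (rule Cauchy_convergent, rule CauchyI)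
    fix r :: real assume r: "0 < r"
    \<comment> \<open>a strictly positive bound, since \<open>M\<close> may vanish or be negative\<close>
    define N where "N = \<bar>M\<bar> + 1"
    have N: "0 < N" "M \<le> N" by (auto simp: N_def)
    obtain n0 where n0: "\<And>m n. m \<ge> n0 \<Longrightarrow> n \<ge> n0 \<Longrightarrow> norm (x m - x n) < r / N"
      using CauchyD[OF LIMSEQ_imp_Cauchy[OF lim], of "r / N"] r N by auto
    have "norm (f t (x m) - f t (x n)) < r" if "m \<ge> n0" "n \<ge> n0" for m n
    proof -
      have "norm (f t (x m) - f t (x n)) = \<bar>f t (x m - x n)\<bar>"
        by (simp add: linear_diff[OF lin[OF t]])
      also have "\<dots> \<le> M * norm (x m - x n)"
        using bound[OF t span_diff] x by blast
      also have "\<dots> \<le> N * norm (x m - x n)" using N by (intro mult_right_mono) auto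
      also have "\<dots> < r" using n0[OF that] N by (simp add: field_simps)
      finally show ?thesis .
    qed
    then show "\<exists>n0. \<forall>m\<ge>n0. \<forall>n\<ge>n0. norm (f t (x m) - f t (x n)) < r" by blast
  qed
  have "(\<lambda>n. \<Sum>t\<in>T. f t (x n) *\<^sub>R e t) \<longlonglongrightarrow> (\<Sum>t\<in>T. lim (\<lambda>n. f t (x n)) *\<^sub>R e t)"
    using conv by (intro tendsto_sum tendsto_scaleR tendsto_const) (simp add: convergent_LIMSEQ_iff)
  moreover have "(\<lambda>n. \<Sum>t\<in>T. f t (x n) *\<^sub>R e t) = x"
    using x by (simp add: expand[symmetric])
  ultimately have "l = (\<Sum>t\<in>T. lim (\<lambda>n. f t (x n)) *\<^sub>R e t)"
    using LIMSEQ_unique[OF lim] by simp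
  then show "l \<in> span T" using e by (simp add: span_sum span_scale)
qed

text \<open>
  Riesz' lemma with the factor one half: \<open>u\<close> is an almost closest point to \<open>w\<close>, and \<open>r\<close> normalises
  \<open>w - u\<close>. The distance estimate is stated as the bound 2 on the coordinate \<open>c\<close> along the new
  direction, which is the form needed to extend a basis.
\<close>

lemma unit_vector_far_from_subspace:
  fixes S :: "'a::real_normed_vector set"
  assumes S: "subspace S" "closed S" and w: "w \<notin> S"
  obtains u r where "u \<in> S" "0 < r" "norm (r *\<^sub>R (w - u)) = 1"
    "\<And>c s. s \<in> S \<Longrightarrow> \<bar>c\<bar> \<le> 2 * norm (c *\<^sub>R (r *\<^sub>R (w - u)) + s)"
proof -
  have ne: "S \<noteq> {}" using S(1) subspace_0 by blast
  define d where "d = infdist w S"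
  have d: "0 < d"
    using in_closed_iff_infdist_zero[OF S(2) ne, of w] w infdist_nonneg[of w S]
    unfolding d_def by linarith
  then have "\<exists>u\<in>S. dist w u < 2 * d"
    using infdist_notempty[OF ne, of w] cInf_lessD[of "dist w ` S" "2 * d"] ne by (auto simp: d_def)
  then obtain u where u: "u \<in> S" "norm (w - u) < 2 * d" by (auto simp: dist_norm)
  define q where "q = norm (w - u)"
  have q: "0 < q" "q < 2 * d" using u w by (auto simp: q_def)
  have far: "\<bar>c\<bar> \<le> 2 * norm (c *\<^sub>R (inverse q *\<^sub>R (w - u)) + s)" if s: "s \<in> S" for c s
  proof (cases "c = 0")
    case False
    \<comment> \<open>chosen so that the vector in question is \<open>(c / q) (w - s')\<close>\<close>
    define s' where "s' = u - (q / c) *\<^sub>R s"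
    have "s' \<in> S" unfolding s'_def using S(1) s u(1) by (simp add: subspace_diff subspace_scale)
    then have "d \<le> norm (w - s')" using infdist_le[of s' S w] by (simp add: d_def dist_norm)
    then have "q / 2 \<le> norm (w - s')" using q by linarith
    moreover have "w - s' = (w - u) + (q / c) *\<^sub>R s" by (simp add: s'_def)
    then have "c *\<^sub>R (inverse q *\<^sub>R (w - u)) + s = (c / q) *\<^sub>R (w - s')"
      using False q by (simp only: scaleR_add_right scaleR_scaleR) (simp add: divide_inverse[symmetric])
    ultimately show ?thesis
      using q(1) mult_left_mono[of "q / 2" "norm (w - s')" "2 * \<bar>c\<bar> / q"] by simp
  qed simp
  show ?thesis
    by (rule that[of u "inverse q"]) (use u q far in \<open>auto simp: q_def\<close>)
qed

text \<open>
  The point is that the bound depends on the dimension only, not on the subspace or its norm.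
  A new unit vector \<open>x\<close> at distance at least one half from the old span has a coordinate \<open>g\<close> of
  norm at most 2. Splitting off \<open>g v x\<close> from \<open>v\<close> leaves a remainder of norm at most \<open>3 \<parallel>v\<parallel>\<close>, whose
  old coordinates are bounded by induction; hence the factor 3 per dimension. The basis \<open>e\<close> and its
  dual \<open>f\<close> are indexed by the vectors of the given basis \<open>T\<close>, and the \<open>f t\<close> are linear on the whole
  space but controlled only on the span.
\<close>

lemma well_conditioned_coordinates:
  fixes T :: "'a::real_normed_vector set"
  assumes "finite T" "independent T"
  shows "\<exists>e f. (\<forall>t\<in>T. e t \<in> span T \<and> norm (e t) = 1 \<and> linear (f t)) \<and>
    (\<forall>t\<in>T. \<forall>v\<in>span T. \<bar>f t v\<bar> \<le> 2 * 3 ^ card T * norm v) \<and>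
    (\<forall>v\<in>span T. v = (\<Sum>t\<in>T. f t v *\<^sub>R e t))"
  using assms
proof (induction T rule: finite_induct)
  case empty
  then show ?case by simp
next
  case (insert w T)
  let ?M = "2 * 3 ^ card T :: real"
  have w: "w \<notin> span T" and ind: "independent T"
    using insert.prems insert.hyps by (auto simp: independent_insert)
  obtain e f where "\<forall>t\<in>T. e t \<in> span T \<and> norm (e t) = 1 \<and> linear (f t)"
      "\<forall>t\<in>T. \<forall>v\<in>span T. \<bar>f t v\<bar> \<le> ?M * norm v"
    and expand: "\<And>v. v \<in> span T \<Longrightarrow> v = (\<Sum>t\<in>T. f t v *\<^sub>R e t)"
    using insert.IH[OF ind] by blast
  then have e: "\<And>t. t \<in> T \<Longrightarrow> e t \<in> span T" "\<And>t. t \<in> T \<Longrightarrow> norm (e t) = 1"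
    and f: "\<And>t. t \<in> T \<Longrightarrow> linear (f t)"
    and bound: "\<And>t v. t \<in> T \<Longrightarrow> v \<in> span T \<Longrightarrow> \<bar>f t v\<bar> \<le> ?M * norm v"
    by blast+
  have "closed (span T)"
    using span_closed_if_bounded_coordinates[OF insert.hyps(1) e(1) f bound expand] .
  then obtain u r where u: "u \<in> span T" and r: "0 < r" and unit: "norm (r *\<^sub>R (w - u)) = 1"
    and far: "\<And>c s. s \<in> span T \<Longrightarrow> \<bar>c\<bar> \<le> 2 * norm (c *\<^sub>R (r *\<^sub>R (w - u)) + s)"
    using unit_vector_far_from_subspace[OF subspace_span _ w] by metis
  define x where "x = r *\<^sub>R (w - u)"
  obtain g0 :: "'a \<Rightarrow> real" where g0: "linear g0" "g0 w = 1" "\<And>t. t \<in> T \<Longrightarrow> g0 t = 0"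
    using linear_independent_extend[OF insert.prems, of "\<lambda>t. if t = w then 1 else 0"]
      insert.hyps(2) by (metis insert_iff)
  have g0_span: "g0 s = 0" if "s \<in> span T" for s
    using linear_eq_0_on_span[OF g0(1) g0(3) that] by blast
  \<comment> \<open>\<open>g0\<close> is the coordinate along \<open>w\<close>; dividing by \<open>r\<close> turns it into the one along \<open>x\<close>.\<close>
  define g where "g v = inverse r * g0 v" for v
  have g: "linear g" unfolding g_def using linear_compose_scale_right[OF g0(1), of "inverse r"] by simp
  define h where "h v = v - g v *\<^sub>R x" for v
  have h: "linear h"
    unfolding h_def by (rule linearI) (simp_all add: linear_add[OF g] linear_scale[OF g] algebra_simps)
  have h_span: "h v \<in> span T" if v: "v \<in> span (insert w T)" for v
  proof -
    obtain k where k: "v - k *\<^sub>R w \<in> span T" using v span_breakdown_eq by metis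
    have "g0 v = k"
      using g0_span[OF k] g0(2) by (simp add: linear_diff[OF g0(1)] linear_scale[OF g0(1)])
    then have "h v = (v - k *\<^sub>R w) + k *\<^sub>R u"
      using r by (simp add: h_def g_def x_def algebra_simps)
    then show ?thesis using k u by (simp add: span_add span_scale)
  qed
  have g_bound: "\<bar>g v\<bar> \<le> 2 * norm v" if v: "v \<in> span (insert w T)" for v
    using far[OF h_span[OF v], of "g v"] by (simp add: h_def x_def)
  have h_bound: "norm (h v) \<le> 3 * norm v" if v: "v \<in> span (insert w T)" for v
  proof -
    have "norm (h v) \<le> norm v + norm (g v *\<^sub>R x)" unfolding h_def by (rule norm_triangle_ineq4)
    also have "\<dots> \<le> 3 * norm v" using g_bound[OF v] unit by (simp add: x_def[symmetric])
    finally show ?thesis .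
  qed
  have span_mono': "span T \<subseteq> span (insert w T)" by (rule span_mono) auto
  define e' where "e' t = (if t = w then x else e t)" for t
  define f' where "f' t = (if t = w then g else f t \<circ> h)" for t
  have card: "card (insert w T) = Suc (card T)" using insert.hyps by simp
  have "e' t \<in> span (insert w T) \<and> norm (e' t) = 1 \<and> linear (f' t)" if "t \<in> insert w T" for t
  proof (cases "t = w")
    case True
    have "x \<in> span (insert w T)"
      unfolding x_def using u span_mono' by (intro span_scale span_diff) (auto intro: span_base)
    then show ?thesis using True unit g by (simp add: e'_def f'_def x_def)
  next
    case False
    then have t: "t \<in> T" using that by simp
    then show ?thesis
      using False e span_mono' linear_compose[OF h f[OF t]] by (auto simp: e'_def f'_def)
  qed
  moreover have "\<bar>f' t v\<bar> \<le> 2 * 3 ^ card (insert w T) * norm v"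
    if t: "t \<in> insert w T" and v: "v \<in> span (insert w T)" for t v
  proof (cases "t = w")
    case True
    have "2 * norm v \<le> 2 * 3 ^ card (insert w T) * norm v"
      using one_le_power[of "3::real"] by (intro mult_right_mono) auto
    then have "\<bar>g v\<bar> \<le> 2 * 3 ^ card (insert w T) * norm v" using g_bound[OF v] by linarith
    then show ?thesis using True by (simp add: f'_def)
  next
    case False
    then have "\<bar>f' t v\<bar> \<le> ?M * norm (h v)"
      using t bound[OF _ h_span[OF v]] by (auto simp: f'_def)
    also have "\<dots> \<le> ?M * (3 * norm v)" using h_bound[OF v] by (intro mult_left_mono) auto
    finally show ?thesis unfolding card by simp
  qed
  moreover have "v = (\<Sum>t\<in>insert w T. f' t v *\<^sub>R e' t)" if v: "v \<in> span (insert w T)" for v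
  proof -
    have "(\<Sum>t\<in>T. f' t v *\<^sub>R e' t) = (\<Sum>t\<in>T. f t (h v) *\<^sub>R e t)"
      using insert.hyps by (intro sum.cong) (auto simp: f'_def e'_def)
    also have "\<dots> = h v" using expand[OF h_span[OF v]] by simp
    finally have "(\<Sum>t\<in>insert w T. f' t v *\<^sub>R e' t) = g v *\<^sub>R x + h v"
      using insert.hyps by (simp add: f'_def e'_def)
    then show ?thesis by (simp add: h_def)
  qed
  ultimately show ?case by blast
qed

text \<open>
  A linear map with kernel \<open>S\<close> induces an isomorphism from the quotient by \<open>S\<close> onto its range, so it
  carries representatives of a basis of the quotient to a basis of the range.
\<close>

lemma basis_of_range_if_kernel_codim:
  assumes codim: "has_codim S K" and P: "linear P" "\<And>v. P v = 0 \<longleftrightarrow> v \<in> S"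
  obtains w where "inj_on w {1..K}" "independent (w ` {1..K})" "range P = span (w ` {1..K})"
proof -
  obtain w where ind: "\<And>c :: nat \<Rightarrow> real. (\<Sum>k=1..K. c k *\<^sub>R w k) \<in> S \<Longrightarrow> \<forall>k\<in>{1..K}. c k = 0"
    and sp: "\<And>v. \<exists>c :: nat \<Rightarrow> real. v - (\<Sum>k=1..K. c k *\<^sub>R w k) \<in> S"
    using codim unfolding has_codim_def by metis
  have P_sum: "P (\<Sum>k=1..K. c k *\<^sub>R w k) = (\<Sum>k=1..K. c k *\<^sub>R P (w k))" for c :: "nat \<Rightarrow> real"
    by (simp add: linear_sum[OF P(1)] linear_scale[OF P(1)])
  have zero: "\<forall>k\<in>{1..K}. c k = 0" if "(\<Sum>k=1..K. c k *\<^sub>R P (w k)) = 0" for c :: "nat \<Rightarrow> real"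
    using that ind P(2) P_sum by metis
  have inj: "inj_on (\<lambda>k. P (w k)) {1..K}"
  proof (rule inj_onI, rule ccontr)
    fix i j assume ij: "i \<in> {1..K}" "j \<in> {1..K}" "P (w i) = P (w j)" "i \<noteq> j"
    \<comment> \<open>a nontrivial relation between the two equal vectors\<close>
    let ?c = "\<lambda>k. (if k = i then 1 else 0) - (if k = j then 1 else 0) :: real"
    have "(\<Sum>k=1..K. ?c k *\<^sub>R P (w k)) =
      (\<Sum>k=1..K. if k = i then P (w k) else 0) - (\<Sum>k=1..K. if k = j then P (w k) else 0)"
      unfolding sum_subtractf[symmetric] by (intro sum.cong) (auto simp: algebra_simps)
    also have "\<dots> = 0" using ij by (simp add: sum.delta)
    finally have "?c i = 0" using zero[of ?c] ij(1) by blast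
    then show False using ij(4) by simp
  qed
  let ?T = "(\<lambda>k. P (w k)) ` {1..K}"
  have "independent ?T"
  proof (rule independent_if_scalars_zero)
    fix c :: "'b \<Rightarrow> real" and t assume c: "(\<Sum>t\<in>?T. c t *\<^sub>R t) = 0" and t: "t \<in> ?T"
    have "(\<Sum>k=1..K. c (P (w k)) *\<^sub>R P (w k)) = 0"
      using c unfolding sum.reindex[OF inj] o_def .
    then show "c t = 0" using zero[of "\<lambda>k. c (P (w k))"] t by blast
  qed simp
  moreover have "range P = span ?T"
  proof
    show "range P \<subseteq> span ?T"
    proof clarify
      fix v
      obtain c where "v - (\<Sum>k=1..K. c k *\<^sub>R w k) \<in> S" using sp by blast
      then have "P v = (\<Sum>k=1..K. c k *\<^sub>R P (w k))"
        using P(2) P_sum linear_diff[OF P(1)] by (metis eq_iff_diff_eq_0)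
      then show "P v \<in> span ?T" by (auto intro!: span_sum span_scale intro: span_base)
    qed
    show "span ?T \<subseteq> range P"
      by (rule span_minimal) (auto intro: linear_subspace_image[OF P(1)] subspace_UNIV)
  qed
  ultimately show ?thesis using that[of "\<lambda>k. P (w k)"] inj by blast
qed

lemma max_upto_upper: "k \<in> {1..K} \<Longrightarrow> f k \<le> max_upto K f"
  by (auto simp: max_upto_def)

lemma max_upto_least: "0 \<le> c \<Longrightarrow> (\<And>k. k \<in> {1..K} \<Longrightarrow> f k \<le> c) \<Longrightarrow> max_upto K f \<le> c"
  by (auto simp: max_upto_def)

text \<open>
  The functionals are the well-conditioned coordinates on the range of \<open>P\<close>, composed with \<open>P\<close>.
  The composition makes them continuous on the whole space. Both constants depend on \<open>K\<close> only,
  so they serve a whole sequence of operators at once.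
\<close>

lemma norm_equiv_max_functionals:
  fixes P :: "'a::real_normed_vector \<Rightarrow>\<^sub>L 'a"
  assumes codim: "has_codim S K"
    and P0: "\<And>v. P v = 0 \<longleftrightarrow> v \<in> S"
  obtains \<alpha> :: "nat \<Rightarrow> 'a \<Rightarrow>\<^sub>L real" where
    "\<And>v. max_upto K (\<lambda>k. \<bar>\<alpha> k v\<bar>) \<le> 2 * 3 ^ K * norm (P v)"
    "\<And>v. norm (P v) \<le> real K * max_upto K (\<lambda>k. \<bar>\<alpha> k v\<bar>)"
proof -
  have linP: "linear P" by (simp add: bounded_linear.linear blinfun.bounded_linear_right)
  obtain w where inj: "inj_on w {1..K}" and ind: "independent (w ` {1..K})"
    and range: "range P = span (w ` {1..K})"
    using basis_of_range_if_kernel_codim[OF codim linP P0] by blast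
  have card: "card (w ` {1..K}) = K" using card_image[OF inj] by simp
  let ?T = "w ` {1..K}"
  obtain e f where "\<forall>t\<in>?T. e t \<in> range P \<and> norm (e t) = 1 \<and> linear (f t)"
      "\<forall>t\<in>?T. \<forall>v\<in>range P. \<bar>f t v\<bar> \<le> 2 * 3 ^ K * norm v"
      "\<forall>v\<in>range P. v = (\<Sum>t\<in>?T. f t v *\<^sub>R e t)"
    using well_conditioned_coordinates[OF _ ind] unfolding card range[symmetric] by blast
  then have ef: "\<And>k. k \<in> {1..K} \<Longrightarrow> norm (e (w k)) = 1"
      "\<And>k. k \<in> {1..K} \<Longrightarrow> linear (f (w k))"
    and bound: "\<And>k v. k \<in> {1..K} \<Longrightarrow> \<bar>f (w k) (P v)\<bar> \<le> 2 * 3 ^ K * norm (P v)"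
    and expand: "\<And>v. P v = (\<Sum>t\<in>?T. f t (P v) *\<^sub>R e t)"
    by blast+
  define \<alpha> where "\<alpha> k = Blinfun (\<lambda>v. f (w k) (P v))" for k
  have \<alpha>: "\<alpha> k v = f (w k) (P v)" if k: "k \<in> {1..K}" for k v
  proof -
    have "\<bar>f (w k) (P v)\<bar> \<le> norm v * (2 * 3 ^ K * norm P)" for v
      using order_trans[OF bound[OF k] mult_left_mono[OF norm_blinfun[of P v], of "2 * 3 ^ K"]]
      by (simp add: mult_ac)
    then have "bounded_linear (\<lambda>v. f (w k) (P v))"
      using linear_compose[OF linP ef(2)[OF k]]
      by (intro bounded_linear_intro)
        (auto simp: o_def linear_add linear_scale linP ef(2)[OF k])
    then show ?thesis by (simp add: \<alpha>_def bounded_linear_Blinfun_apply)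
  qed
  show ?thesis
  proof (rule that[of \<alpha>])
    fix v
    show "max_upto K (\<lambda>k. \<bar>\<alpha> k v\<bar>) \<le> 2 * 3 ^ K * norm (P v)"
      by (rule max_upto_least) (use \<alpha> bound in auto)
    have "P v = (\<Sum>k=1..K. f (w k) (P v) *\<^sub>R e (w k))"
      using expand[of v] unfolding sum.reindex[OF inj] o_def .
    then have "norm (P v) = norm (\<Sum>k=1..K. \<alpha> k v *\<^sub>R e (w k))" using \<alpha> by simp
    also have "\<dots> \<le> (\<Sum>k=1..K. max_upto K (\<lambda>k. \<bar>\<alpha> k v\<bar>))"
      by (intro sum_norm_le) (simp add: ef(1) max_upto_upper[of _ K "\<lambda>k. \<bar>\<alpha> k v\<bar>"])
    finally show "norm (P v) \<le> real K * max_upto K (\<lambda>k. \<bar>\<alpha> k v\<bar>)" by simp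
  qed
qed

section \<open>Seminorms adapted to a dichotomy\<close>

lemma evol_cocycle:
  assumes "n \<le> k" "k \<le> m"
  shows "evol B m n v = evol B m k (evol B k n v)"
  using assms(2,1) by (induction m rule: dec_induct) (auto simp: evol_refl)

lemma evol_one: "evol B (Suc n) n = B n"
  by (rule blinfun_eqI) (simp add: evol_refl)

lemma projection_alongD:
  assumes ds: "direct_sum S U" and P: "projection_along S U P" and Q: "projection_along U S Q"
  shows "P v + Q v = v" "P v \<in> S" "P v = 0 \<longleftrightarrow> v \<in> U"
proof -
  have sub: "subspace S" "subspace U" and int: "S \<inter> U = {0}"
    using ds by (auto simp: direct_sum_def)
  have "v \<in> {s + u | s u. s \<in> S \<and> u \<in> U}" using ds by (simp add: direct_sum_def)
  then obtain s u where su: "s \<in> S" "u \<in> U" "v = s + u" by blast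
  have v: "P v = s" "Q v = u"
    using su P Q by (auto simp: projection_along_def add.commute)
  then show "P v + Q v = v" "P v \<in> S" using su by auto
  show "P v = 0 \<longleftrightarrow> v \<in> U"
  proof
    assume "v \<in> U"
    then have "s \<in> U" using su sub subspace_diff[of U v u] by simp
    then show "P v = 0" using v su int by auto
  qed (use v su in auto)
qed

text \<open>
  An exponential dichotomy with chosen projections and constant. Invariance is recorded for single
  steps, which is how the seminorms use it, and the exponent \<open>n - m\<close> in the backward estimate is
  expressed by division.
\<close>

locale dichotomy =
  fixes B :: "nat \<Rightarrow> 'a::real_normed_vector \<Rightarrow>\<^sub>L 'a" and a b C :: real
    and Xs Xu :: "nat \<Rightarrow> 'a set" and \<pi>s \<pi>u :: "nat \<Rightarrow> 'a \<Rightarrow>\<^sub>L 'a"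
  assumes a: "0 < a" and b: "0 < b" and C: "0 < C"
    and ds: "direct_sum (Xs n) (Xu n)"
    and proj_s: "projection_along (Xs n) (Xu n) (\<pi>s n)"
    and proj_u: "projection_along (Xu n) (Xs n) (\<pi>u n)"
    and commute_s: "\<pi>s (Suc n) (B n v) = B n (\<pi>s n v)"
    and commute_u: "\<pi>u (Suc n) (B n v) = B n (\<pi>u n v)"
    and proj_bound: "norm (\<pi>s n) + norm (\<pi>u n) \<le> C"
    and bij: "n \<le> m \<Longrightarrow> bij_betw (evol B m n) (Xu n) (Xu m)"
    and stable_bound: "n \<le> m \<Longrightarrow> v \<in> Xs n \<Longrightarrow> norm (evol B m n v) \<le> C * a ^ (m - n) * norm v"
    and unstable_bound: "n \<le> m \<Longrightarrow> v \<in> Xu m \<Longrightarrow>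
      norm (inv_into (Xu n) (evol B m n) v) \<le> C / b ^ (m - n) * norm v"
begin

lemma ds': "direct_sum (Xu n) (Xs n)"
proof -
  have "{u + s | u s. u \<in> Xu n \<and> s \<in> Xs n} = {s + u | s u. s \<in> Xs n \<and> u \<in> Xu n}"
    by (metis (no_types, opaque_lifting) add.commute)
  then show ?thesis using ds[of n] by (simp add: direct_sum_def Int_commute)
qed

lemmas \<pi>s = projection_alongD[OF ds proj_s proj_u]
lemmas \<pi>u = projection_alongD[OF ds' proj_u proj_s]

abbreviation pullback :: "nat \<Rightarrow> nat \<Rightarrow> 'a \<Rightarrow> 'a" where
  "pullback m n \<equiv> inv_into (Xu n) (evol B m n)"

lemma back_in: "n \<le> m \<Longrightarrow> v \<in> Xu m \<Longrightarrow> pullback m n v \<in> Xu n"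
  using bij[of n m] by (metis bij_betw_imp_surj_on inv_into_into)

lemma evol_back: "n \<le> m \<Longrightarrow> v \<in> Xu m \<Longrightarrow> evol B m n (pullback m n v) = v"
  using bij[of n m] by (metis bij_betw_imp_surj_on f_inv_into_f)

lemma back_eqI: "n \<le> m \<Longrightarrow> y \<in> Xu n \<Longrightarrow> evol B m n y = v \<Longrightarrow> pullback m n v = y"
  using bij[of n m] by (metis bij_betw_imp_inj_on inv_into_f_f)

lemma linear_back_proj:
  assumes nm: "n \<le> m"
  shows "linear (\<lambda>v. pullback m n (\<pi>u m v))"
proof -
  have sub: "subspace (Xu n)" using ds[of n] by (simp add: direct_sum_def)
  note in_n = back_in[OF nm \<pi>u(2)] and ev = evol_back[OF nm \<pi>u(2)]
  show ?thesis
    by (rule linearI; rule back_eqI[OF nm])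
      (simp_all add: in_n ev subspace_add[OF sub] subspace_scale[OF sub] blinfun.add_right blinfun.scaleR_right)
qed

definition Iminus :: "nat \<Rightarrow> 'a \<Rightarrow> real" where
  "Iminus n v = (SUP m\<in>{n..}. 1 / a ^ (m - n) * norm (evol B m n (\<pi>s n v)))"

definition Iplus :: "nat \<Rightarrow> 'a \<Rightarrow> real" where
  "Iplus n v = (SUP k\<in>{..n}. b ^ (n - k) * norm (pullback n k (\<pi>u n v)))"

lemma minus_term_bound: "n \<le> m \<Longrightarrow> 1 / a ^ (m - n) * norm (evol B m n (\<pi>s n v)) \<le> C * norm (\<pi>s n v)"
  using stable_bound[OF _ \<pi>s(2), of n m v] a by (simp add: divide_le_eq mult_ac)

lemma plus_term_bound: "k \<le> n \<Longrightarrow> b ^ (n - k) * norm (pullback n k (\<pi>u n v)) \<le> C * norm (\<pi>u n v)"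
  using unstable_bound[OF _ \<pi>u(2), of k n v] b by (simp add: field_simps)

lemma bdd_minus: "bdd_above ((\<lambda>m. 1 / a ^ (m - n) * norm (evol B m n (\<pi>s n v))) ` {n..})"
  using minus_term_bound by (intro bdd_aboveI2) auto

lemma bdd_plus: "bdd_above ((\<lambda>k. b ^ (n - k) * norm (pullback n k (\<pi>u n v))) ` {..n})"
  by simp

lemma seminorm_Iminus: "is_seminorm (Iminus n)"
  unfolding Iminus_def
proof (rule is_seminorm_SUP[OF _ _ bdd_minus])
  fix m
  show "is_seminorm (\<lambda>v. 1 / a ^ (m - n) * norm (evol B m n (\<pi>s n v)))"
    using a by (intro is_seminorm_norm_linear linearI)
      (simp_all add: blinfun.add_right blinfun.scaleR_right)
qed simp

lemma seminorm_Iplus: "is_seminorm (Iplus n)"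
  unfolding Iplus_def
proof (rule is_seminorm_SUP[OF _ _ bdd_plus])
  fix k assume "k \<in> {..n}"
  then show "is_seminorm (\<lambda>v. b ^ (n - k) * norm (pullback n k (\<pi>u n v)))"
    using b by (intro is_seminorm_norm_linear linear_back_proj) simp_all
qed simp

lemma Iminus_bounds: "norm (\<pi>s n v) \<le> Iminus n v" "Iminus n v \<le> C * norm (\<pi>s n v)"
proof -
  show "norm (\<pi>s n v) \<le> Iminus n v"
    using cSUP_upper[OF _ bdd_minus, of n n v] by (simp add: Iminus_def evol_refl)
  show "Iminus n v \<le> C * norm (\<pi>s n v)"
    unfolding Iminus_def by (rule cSUP_least) (use minus_term_bound in auto)
qed

lemma Iplus_bounds: "norm (\<pi>u n v) \<le> Iplus n v" "Iplus n v \<le> C * norm (\<pi>u n v)"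
proof -
  have "pullback n n (\<pi>u n v) = \<pi>u n v" by (rule back_eqI) (simp_all add: \<pi>u evol_refl)
  then show "norm (\<pi>u n v) \<le> Iplus n v"
    using cSUP_upper[OF _ bdd_plus, of n n v] by (simp add: Iplus_def)
  show "Iplus n v \<le> C * norm (\<pi>u n v)"
    unfolding Iplus_def by (rule cSUP_least) (use plus_term_bound in auto)
qed

lemma Iminus_eq_0_iff: "Iminus n v = 0 \<longleftrightarrow> v \<in> Xu n"
  using Iminus_bounds[of n v] \<pi>s(3)[of n v] by fastforce

lemma Iplus_eq_0_iff: "Iplus n v = 0 \<longleftrightarrow> v \<in> Xs n"
  using Iplus_bounds[of n v] \<pi>u(3)[of n v] by fastforce

text \<open>
  By invariance, the orbit of the stable part of \<open>B n v\<close> is the tail of the orbit of that of \<open>v\<close>, and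
  starting one step later costs exactly one factor \<open>a\<close> in the weights.
\<close>

lemma Iminus_step: "Iminus (Suc n) (B n v) \<le> a * Iminus n v"
  unfolding Iminus_def[of "Suc n"]
proof (rule cSUP_least)
  fix m assume "m \<in> {Suc n..}"
  then have m: "Suc n \<le> m" by simp
  have "evol B m (Suc n) (\<pi>s (Suc n) (B n v)) = evol B m n (\<pi>s n v)"
    using evol_cocycle[of n "Suc n" m B] m by (simp add: commute_s evol_one del: evol.simps)
  moreover have "m - n = Suc (m - Suc n)" using m by simp
  then have "1 / a ^ (m - Suc n) = a * (1 / a ^ (m - n))" using a by simp
  moreover have "1 / a ^ (m - n) * norm (evol B m n (\<pi>s n v)) \<le> Iminus n v"
    unfolding Iminus_def by (rule cSUP_upper[OF _ bdd_minus]) (use m in auto)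
  ultimately show "1 / a ^ (m - Suc n) * norm (evol B m (Suc n) (\<pi>s (Suc n) (B n v))) \<le> a * Iminus n v"
    using a by (metis mult.assoc mult_left_mono less_imp_le)
qed simp

text \<open>
  Dually, the past of the unstable part of \<open>B n v\<close> extends the past of that of \<open>v\<close> by one point, and
  each of the old points gains one factor \<open>b\<close> in its weight.
\<close>

lemma Iplus_step: "b * Iplus n v \<le> Iplus (Suc n) (B n v)"
proof -
  have "b ^ (n - k) * norm (pullback n k (\<pi>u n v)) \<le> Iplus (Suc n) (B n v) / b" if k: "k \<le> n" for k
  proof -
    have "pullback (Suc n) k (\<pi>u (Suc n) (B n v)) = pullback n k (\<pi>u n v)"
      using k by (intro back_eqI) (simp_all add: back_in evol_back \<pi>u(2) commute_u)
    moreover have "b ^ (Suc n - k) * norm (pullback (Suc n) k (\<pi>u (Suc n) (B n v))) \<le> Iplus (Suc n) (B n v)"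
      unfolding Iplus_def by (rule cSUP_upper[OF _ bdd_plus]) (use k in auto)
    ultimately show ?thesis using k b by (simp add: Suc_diff_le field_simps)
  qed
  then have "Iplus n v \<le> Iplus (Suc n) (B n v) / b"
    unfolding Iplus_def[of n] by (intro cSUP_least) auto
  then show ?thesis using b by (simp add: field_simps)
qed

text \<open>
  The natural constants are 1 below and \<open>C\<^sup>2\<close> above, one factor \<open>C\<close> from the growth estimates and
  one from the projections. The sum \<open>C\<^sup>2 + 1\<close> allows a single constant for both sides.
\<close>

lemma equivalent_norm:
  shows "1 / (C\<^sup>2 + 1) * norm v \<le> Iminus n v + Iplus n v"
    and "Iminus n v + Iplus n v \<le> (C\<^sup>2 + 1) * norm v"
proof -
  have "1 / (C\<^sup>2 + 1) * norm v \<le> 1 * norm v"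
    by (intro mult_right_mono) (auto simp: divide_le_eq_1 add_nonneg_pos)
  also have "\<dots> \<le> norm (\<pi>s n v) + norm (\<pi>u n v)"
    using norm_triangle_ineq[of "\<pi>s n v" "\<pi>u n v"] by (simp add: \<pi>s(1))
  also have "\<dots> \<le> Iminus n v + Iplus n v" using Iminus_bounds Iplus_bounds by (intro add_mono)
  finally show "1 / (C\<^sup>2 + 1) * norm v \<le> Iminus n v + Iplus n v" .
  have "Iminus n v + Iplus n v \<le> C * (norm (\<pi>s n v) + norm (\<pi>u n v))"
    using Iminus_bounds(2)[of n v] Iplus_bounds(2)[of n v] by (simp add: distrib_left)
  also have "\<dots> \<le> C * ((norm (\<pi>s n) + norm (\<pi>u n)) * norm v)"
    using C norm_blinfun[of "\<pi>s n" v] norm_blinfun[of "\<pi>u n" v] by (simp add: distrib_right)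
  also have "\<dots> \<le> C * (C * norm v)"
    using C proj_bound by (intro mult_left_mono mult_right_mono) auto
  also have "\<dots> \<le> (C\<^sup>2 + 1) * norm v" by (simp add: power2_eq_square algebra_simps)
  finally show "Iminus n v + Iplus n v \<le> (C\<^sup>2 + 1) * norm v" .
qed

lemma Iplus_equiv_max_functionals:
  assumes codim: "\<And>n. has_codim (Xs n) K"
  shows "\<exists>c>0. \<exists>\<alpha> :: nat \<Rightarrow> nat \<Rightarrow> 'a \<Rightarrow>\<^sub>L real. \<forall>n v.
    c * max_upto K (\<lambda>k. \<bar>\<alpha> k n v\<bar>) \<le> Iplus n v \<and>
    Iplus n v \<le> 1 / c * max_upto K (\<lambda>k. \<bar>\<alpha> k n v\<bar>)"
proof -
  have "\<exists>\<alpha> :: nat \<Rightarrow> 'a \<Rightarrow>\<^sub>L real. \<forall>v.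
    max_upto K (\<lambda>k. \<bar>\<alpha> k v\<bar>) \<le> 2 * 3 ^ K * norm (\<pi>u n v) \<and>
    norm (\<pi>u n v) \<le> real K * max_upto K (\<lambda>k. \<bar>\<alpha> k v\<bar>)" for n
    using norm_equiv_max_functionals[OF codim \<pi>u(3)] by metis
  then obtain \<beta> :: "nat \<Rightarrow> nat \<Rightarrow> 'a \<Rightarrow>\<^sub>L real" where
    \<beta>: "\<And>n v. max_upto K (\<lambda>k. \<bar>\<beta> n k v\<bar>) \<le> 2 * 3 ^ K * norm (\<pi>u n v)"
       "\<And>n v. norm (\<pi>u n v) \<le> real K * max_upto K (\<lambda>k. \<bar>\<beta> n k v\<bar>)" by metis
  define D where "D = 2 * 3 ^ K + C * real K"
  have D: "0 < D" "2 * 3 ^ K \<le> D" "C * real K \<le> D"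
    using C by (auto simp: D_def add_pos_nonneg)
  have "1 / D * max_upto K (\<lambda>k. \<bar>\<beta> n k v\<bar>) \<le> Iplus n v \<and>
    Iplus n v \<le> 1 / (1 / D) * max_upto K (\<lambda>k. \<bar>\<beta> n k v\<bar>)" for n v
  proof
    let ?m = "max_upto K (\<lambda>k. \<bar>\<beta> n k v\<bar>)"
    have m: "0 \<le> ?m" by (auto simp: max_upto_def Max_ge_iff)
    have "?m \<le> 2 * 3 ^ K * norm (\<pi>u n v)" by (rule \<beta>)
    also have "\<dots> \<le> D * Iplus n v"
      using D Iplus_bounds by (intro mult_mono) auto
    finally show "1 / D * ?m \<le> Iplus n v" using D by (simp add: field_simps)
    have "Iplus n v \<le> C * norm (\<pi>u n v)" by (rule Iplus_bounds)
    also have "\<dots> \<le> C * (real K * ?m)" using \<beta>(2) C by (intro mult_left_mono) auto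
    also have "\<dots> \<le> D * ?m" using mult_right_mono[OF D(3) m] by simp
    finally show "Iplus n v \<le> 1 / (1 / D) * ?m" by simp
  qed
  then show ?thesis
    using D(1) by (intro exI[of _ "1 / D"] conjI exI[of _ "\<lambda>k n. \<beta> n k"]) auto
qed

end

lemma exp_dichotomy_imp_dichotomy:
  assumes "exp_dichotomy B a b Xs Xu"
  obtains C \<pi>s \<pi>u where "dichotomy B a b C Xs Xu \<pi>s \<pi>u"
proof -
  obtain \<pi>s \<pi>u C where ab: "0 < a" "a < b" and ds: "\<And>n. direct_sum (Xs n) (Xu n)"
    and proj: "\<And>n. projection_along (Xs n) (Xu n) (\<pi>s n)" "\<And>n. projection_along (Xu n) (Xs n) (\<pi>u n)"
    and C: "C > 0"
    and *: "\<And>n m. n \<le> m \<Longrightarrow>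
           evol B m n o\<^sub>L \<pi>s n = \<pi>s m o\<^sub>L evol B m n \<and>
           evol B m n o\<^sub>L \<pi>u n = \<pi>u m o\<^sub>L evol B m n \<and>
           norm (\<pi>s n) + norm (\<pi>u n) \<le> C \<and>
           bij_betw (evol B m n) (Xu n) (Xu m) \<and>
           (\<forall>v\<in>Xs n. norm (evol B m n v) \<le> C * a ^ (m - n) * norm v) \<and>
           (\<forall>v\<in>Xu m. norm (inv_into (Xu n) (evol B m n) v) \<le> C * b powi (int n - int m) * norm v)"
    using assms unfolding exp_dichotomy_def by metis
  have powi: "b powi (int n - int m) = 1 / b ^ (m - n)" if "n \<le> m" for n m
  proof -
    have "int n - int m = - int (m - n)" using that by simp
    then show ?thesis by (simp only: power_int_minus power_int_of_nat inverse_eq_divide)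
  qed
  have step: "B n o\<^sub>L \<pi>s n = \<pi>s (Suc n) o\<^sub>L B n" "B n o\<^sub>L \<pi>u n = \<pi>u (Suc n) o\<^sub>L B n" for n
    using *[of n "Suc n"] unfolding evol_one by auto
  have "dichotomy B a b C Xs Xu \<pi>s \<pi>u"
  proof
    fix n v
    show "\<pi>s (Suc n) (B n v) = B n (\<pi>s n v)" "\<pi>u (Suc n) (B n v) = B n (\<pi>u n v)"
      using step[of n] by (metis blinfun_apply_blinfun_compose)+
    show "norm (\<pi>s n) + norm (\<pi>u n) \<le> C" using *[of n n] by blast
  next
    fix n m v assume "n \<le> m" "v \<in> Xu m"
    then show "norm (inv_into (Xu n) (evol B m n) v) \<le> C / b ^ (m - n) * norm v"
      using *[of n m] powi[of n m] by auto
  qed (use ab C ds proj * in auto)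
  then show ?thesis by (rule that)
qed

theorem proposition1p6:
  fixes B :: "nat \<Rightarrow> 'a::banach \<Rightarrow>\<^sub>L 'a"
    and a b :: real
    and Xs Xu :: "nat \<Rightarrow> 'a set"
  assumes "exp_dichotomy B a b Xs Xu"
  shows "\<exists>(Iminus :: nat \<Rightarrow> 'a \<Rightarrow> real) (Iplus :: nat \<Rightarrow> 'a \<Rightarrow> real).
    (\<forall>n. is_seminorm (Iminus n) \<and> is_seminorm (Iplus n)) \<and>
    (\<exists>c1>0. \<forall>n.
       (\<forall>v. c1 * norm v \<le> Iminus n v + Iplus n v \<and> Iminus n v + Iplus n v \<le> 1 / c1 * norm v) \<and>
       Xs n = {v. Iplus n v = 0} \<and>
       Xu n = {v. Iminus n v = 0} \<and>
       (\<forall>v. Iminus (Suc n) (B n v) \<le> a * Iminus n v) \<and>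
       (\<forall>v. Iplus (Suc n) (B n v) \<ge> b * Iplus n v)) \<and>
    (\<forall>K. (\<forall>n. has_codim (Xs n) K) \<longrightarrow>
       (\<exists>c2>0. \<exists>\<alpha> :: nat \<Rightarrow> nat \<Rightarrow> 'a \<Rightarrow>\<^sub>L real. \<forall>n v.
          c2 * max_upto K (\<lambda>k. \<bar>\<alpha> k n v\<bar>) \<le> Iplus n v \<and>
          Iplus n v \<le> 1 / c2 * max_upto K (\<lambda>k. \<bar>\<alpha> k n v\<bar>)))"
proof -
  obtain C \<pi>s \<pi>u where "dichotomy B a b C Xs Xu \<pi>s \<pi>u"
    using exp_dichotomy_imp_dichotomy[OF assms] .
  then interpret dichotomy B a b C Xs Xu \<pi>s \<pi>u .
  have c1: "0 < 1 / (C\<^sup>2 + 1)" by (simp add: add_nonneg_pos)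
  have inv: "1 / (1 / (C\<^sup>2 + 1)) = C\<^sup>2 + 1" by simp
  have sets: "Xs n = {v. Iplus n v = 0}" "Xu n = {v. Iminus n v = 0}" for n
    by (simp_all add: Iplus_eq_0_iff Iminus_eq_0_iff)
  have uniform: "\<exists>c1>0. \<forall>n.
       (\<forall>v. c1 * norm v \<le> Iminus n v + Iplus n v \<and> Iminus n v + Iplus n v \<le> 1 / c1 * norm v) \<and>
       Xs n = {v. Iplus n v = 0} \<and>
       Xu n = {v. Iminus n v = 0} \<and>
       (\<forall>v. Iminus (Suc n) (B n v) \<le> a * Iminus n v) \<and>
       (\<forall>v. Iplus (Suc n) (B n v) \<ge> b * Iplus n v)"
    by (rule exI[of _ "1 / (C\<^sup>2 + 1)"], unfold inv)
      (intro conjI allI c1 equivalent_norm sets Iminus_step Iplus_step)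
  show ?thesis
    by (rule exI[of _ Iminus], rule exI[of _ Iplus])
      (intro conjI allI impI seminorm_Iminus seminorm_Iplus uniform Iplus_equiv_max_functionals, blast)
qed

end
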